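(* Let $d \geq 2$ be an integer, let $B \subset \mathbb{R}^d$ be a convex body containing the origin in its interior, and let $0 < \varepsilon \leq 1$. Then $$S(B) < \frac{1}{\varepsilon}\Big(S^*_\varepsilon(B) + 2\rho(B) + 1\Big),$$ where $S(B)$ is the Steinitz constant of $B$, $S^*_\varepsilon(B)$ is the (relaxed) $\varepsilon$-Steinitz constant of $B$, and $\rho(B) = \max_{v \in B} \|-v\|_B$.
   Context: A convex body in $\mathbb{R}^d$ is a compact convex set with non-empty interior. For a convex body $B \subset \mathbb{R}^d$ containing the origin in its interior, define $\|x\|_B := \inf\{r \geq 0 : x \in rB\}$ for $x \in \mathbb{R}^d$. $B$ is not assumed to be symmetric about the origin, so $\|\cdot\|_B$ need only be homogeneous for positive scalars (a possibly asymmetric norm). A finite family of vectors is a finite indexed collection (repetitions are allowed). For a finite family $V$, $\Sigma(V) := \sum_{v \in V} v$ denotes the sum of its elements. For a positive integer $k$, $[k] := \{1,\dots,k\}$. The asymmetry of $B$ is measured by $\rho(B) := \max_{v \in B} \|-v\|_B$ (so $\rho(B) = 1$ if $B = -B$). Steinitz constant: $S(B)$ is the smallest number $C$ such that every finite family of vectors $V \subset B$ with $\Sigma(V) = 0$ has an ordering $v_1, \dots, v_n$ of its elements for which $\big\|\sum_{i \in [k]} v_i\big\|_B \leq C$ for every $k \in [n]$. Relaxed $\varepsilon$-Steinitz constant: for $0 \leq \varepsilon \leq 1$, $S^*_\varepsilon(B)$ is the smallest number $C$ such that every finite family $V \subset \mathbb{R}^d$ of vectors all of whose members $v$ satisfy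 $1-\varepsilon \leq \|v\|_B \leq 1$ (with no condition on $\Sigma(V)$) has an ordering $v_1, \dots, v_n$ of its elements for which $\big\|\sum_{i \in [k]} v_i - \frac{k}{n}\Sigma(V)\big\|_B \leq C$ for every $k \in [n]$. Both constants are known to be well defined and finite: it is a known result (Sevastyanov; Grinberg and Sevastyanov) that $S(B) \leq d$, and one has $S^*_\varepsilon(B) \leq (1+\rho(B))S(B)$. *)

theory Defs
  imports "HOL-Analysis.Analysis" "HOL-Library.Multiset"
begin

definition convex_body :: "(real ^ 'd) set \<Rightarrow> bool" where
  "convex_body B \<longleftrightarrow> compact B \<and> convex B \<and> interior B \<noteq> {}"

definition body_norm :: "(real ^ 'd) set \<Rightarrow> real ^ 'd \<Rightarrow> real" where
  "body_norm B x = Inf {r. r \<ge> 0 \<and> x \<in> (\<lambda>y. r *\<^sub>R y) ` B}"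

definition asymmetry :: "(real ^ 'd) set \<Rightarrow> real" where
  "asymmetry B = (GREATEST r. r \<in> (\<lambda>v. body_norm B (- v)) ` B)"

(* A finite family of vectors (repetitions allowed) is a multiset V; its orderings
   are exactly the lists vs with mset vs = V, and sum_list (take k vs) is the
   k-th partial sum. *)

definition steinitz_bound :: "(real ^ 'd) set \<Rightarrow> real \<Rightarrow> bool" where
  "steinitz_bound B C \<longleftrightarrow>
     (\<forall>V. set_mset V \<subseteq> B \<and> sum_mset V = 0 \<longrightarrow>
       (\<exists>vs. mset vs = V \<and>
          (\<forall>k\<in>{1..length vs}. body_norm B (sum_list (take k vs)) \<le> C)))"

definition steinitz_const :: "(real ^ 'd) set \<Rightarrow> real" where
  "steinitz_const B = (LEAST C. steinitz_bound B C)"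

definition relaxed_steinitz_bound :: "real \<Rightarrow> (real ^ 'd) set \<Rightarrow> real \<Rightarrow> bool" where
  "relaxed_steinitz_bound \<epsilon> B C \<longleftrightarrow>
     (\<forall>V. (\<forall>v\<in>#V. 1 - \<epsilon> \<le> body_norm B v \<and> body_norm B v \<le> 1) \<longrightarrow>
       (\<exists>vs. mset vs = V \<and>
          (\<forall>k\<in>{1..length vs}.
             body_norm B (sum_list (take k vs) -
               (real k / real (length vs)) *\<^sub>R sum_mset V) \<le> C)))"

definition relaxed_steinitz_const :: "real \<Rightarrow> (real ^ 'd) set \<Rightarrow> real" where
  "relaxed_steinitz_const \<epsilon> B = (LEAST C. relaxed_steinitz_bound \<epsilon> B C)"

end

theory Submission
  imports Defs
begin

text \<open>
  Cut an arbitrary ordering of a family with sum zero greedily into consecutive blocks, closing a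
  block as soon as its sum has norm at least \<open>t = (1 - \<epsilon>) / \<epsilon>\<close>. Scaled by \<open>\<epsilon>\<close>, the block sums have
  norms in \<open>[1 - \<epsilon>, 1]\<close>, so they can be reordered by means of the relaxed constant; a proper prefix
  of a block, and the unfinished last block, which is left at the end, have norm at most \<open>t\<close>. This
  gives \<open>\<epsilon> S \<le> S\<^sup>* + (1 - \<epsilon>) (\<rho> + 1)\<close>. That both constants are genuine minima follows from
  finiteness, which is the Grinberg--Sevastyanov argument: as the prefixes are shortened one vector
  at a time, one maintains weights in \<open>[0, 1]\<close> that annihilate the vectors of the prefix and have
  total mass equal to its length minus the dimension.
\<close>

section \<open>The Steinitz lemma for the Euclidean norm\<close>

text \<open>An injective family has too many distinct values to be independent; if instead two
  indices share a value, the coefficients 1 and -1 on them give the relation. Indexing keeps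
  repeated vectors apart.\<close>

lemma exists_nontrivial_relation:
  fixes f :: "'i \<Rightarrow> 'a::euclidean_space"
  assumes "finite I" "card I > DIM('a)"
  obtains c where "(\<Sum>i\<in>I. c i *\<^sub>R f i) = 0" "\<exists>i\<in>I. c i \<noteq> 0"
proof (cases "inj_on f I")
  case True
  then have "dependent (f ` I)"
    using assms by (intro dependent_biggerset) (auto simp: card_image)
  then obtain u v where u: "(\<Sum>v\<in>f ` I. u v *\<^sub>R v) = 0" "v \<in> f ` I" "u v \<noteq> 0"
    using assms(1) by (auto simp: dependent_finite)
  have "(\<Sum>i\<in>I. u (f i) *\<^sub>R f i) = 0"
    using u(1) True by (simp add: sum.reindex)
  with u(2,3) show ?thesis by (intro that[of "u \<circ> f"]) auto
next
  case False
  then obtain i j where ij: "i \<in> I" "j \<in> I" "i \<noteq> j" "f i = f j"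
    by (auto simp: inj_on_def)
  define c where "c = (\<lambda>k. if k = i then 1 else if k = j then -1 else (0::real))"
  have "(\<Sum>k\<in>I. c k *\<^sub>R f k) = (\<Sum>k\<in>{i, j}. c k *\<^sub>R f k)"
    using assms(1) ij by (intro sum.mono_neutral_right) (auto simp: c_def)
  also have "\<dots> = 0" using ij by (simp add: c_def)
  finally show ?thesis using ij by (intro that[of c]) (auto simp: c_def)
qed

text \<open>Points of a polytope: the unit cube cut by the linear relations among the vectors and by
  a mass condition. In the induction on prefixes \<open>s\<close> is the cardinality of
  \<open>I\<close> minus the dimension.\<close>

definition vanishing_weights :: "'i set \<Rightarrow> ('i \<Rightarrow> 'a::real_vector) \<Rightarrow> ('i \<Rightarrow> real) \<Rightarrow> real \<Rightarrow> bool" where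
  "vanishing_weights I f l s \<longleftrightarrow>
     (\<forall>i\<in>I. 0 \<le> l i \<and> l i \<le> 1) \<and> (\<Sum>i\<in>I. l i *\<^sub>R f i) = 0 \<and> (\<Sum>i\<in>I. l i) = s"

lemma vanishing_weights_scale:
  assumes "vanishing_weights I f l s" "0 \<le> a" "a \<le> 1"
  shows "vanishing_weights I f (\<lambda>i. a * l i) (a * s)"
proof -
  have "(\<Sum>i\<in>I. (a * l i) *\<^sub>R f i) = a *\<^sub>R (\<Sum>i\<in>I. l i *\<^sub>R f i)"
    by (simp add: scaleR_right.sum)
  then show ?thesis
    using assms by (auto simp: vanishing_weights_def mult_le_one simp flip: sum_distrib_left)
qed

text \<open>Moving along a relation among the fractional coordinates until one of them hits 0 or 1.\<close>

lemma reduce_fractional: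
  fixes f :: "'i \<Rightarrow> 'a::euclidean_space"
  assumes "finite I" and w: "vanishing_weights I f l s"
    and many: "card {i\<in>I. 0 < l i \<and> l i < 1} > Suc DIM('a)"
  shows "\<exists>m. vanishing_weights I f m s \<and>
    card {i\<in>I. 0 < m i \<and> m i < 1} < card {i\<in>I. 0 < l i \<and> l i < 1}"
proof -
  let ?F = "{i\<in>I. 0 < l i \<and> l i < 1}"
  have finF: "finite ?F" using assms(1) by simp
  \<comment> \<open>Appending a coordinate 1 to each vector makes the relation preserve the total
    mass as well; it also raises the dimension by one, whence the threshold
    \<open>Suc DIM('a)\<close>.\<close>
  obtain c0 where c0: "(\<Sum>i\<in>?F. c0 i *\<^sub>R (f i, 1::real)) = 0" "\<exists>i\<in>?F. c0 i \<noteq> 0"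
    using exists_nontrivial_relation[OF finF, of "\<lambda>i. (f i, 1::real)"] many by auto
  define c where "c = (\<lambda>i. if i \<in> ?F then c0 i else 0)"
  have cF: "(\<Sum>i\<in>I. c i *\<^sub>R g i) = (\<Sum>i\<in>?F. c0 i *\<^sub>R g i)" for g :: "'i \<Rightarrow> 'b::real_vector"
    using assms(1) by (intro sum.mono_neutral_cong_right) (auto simp: c_def)
  have "(\<Sum>i\<in>I. c i *\<^sub>R (f i, 1::real)) = 0" using c0(1) by (simp only: cF)
  then have cf: "(\<Sum>i\<in>I. c i *\<^sub>R f i) = 0" and cs: "(\<Sum>i\<in>I. c i) = 0"
    by (auto simp: prod_eq_iff fst_sum snd_sum)
  define G where "G = {i\<in>?F. c i \<noteq> 0}"
  have G: "finite G" "G \<noteq> {}" using c0(2) assms(1) by (auto simp: G_def c_def)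
  have G_sub: "G \<subseteq> ?F" by (auto simp: G_def)
  \<comment> \<open>\<open>h i\<close> is the step length at which coordinate \<open>i\<close>
    reaches 1 (if \<open>c i > 0\<close>) or 0 (if \<open>c i < 0\<close>). The least of these,
    \<open>t\<close>, keeps all weights in [0, 1] and makes one more of them integral.\<close>
  define h where "h = (\<lambda>i. if c i > 0 then (1 - l i) / c i else l i / (- c i))"
  define t where "t = Min (h ` G)"
  have hpos: "h i > 0" if "i \<in> G" for i using that by (auto simp: G_def h_def field_simps)
  have t_in: "t \<in> h ` G" unfolding t_def using G by simp
  then have tpos: "t > 0" using hpos by auto
  have tle: "t \<le> h i" if "i \<in> G" for i unfolding t_def using G that by simp
  define m where "m = (\<lambda>i. l i + t * c i)"
  have m_outside: "m i = l i" if "i \<in> I - G" for i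
    using that by (auto simp: m_def G_def c_def)
  have m_range: "0 \<le> m i \<and> m i \<le> 1" if "i \<in> I" for i
  proof (cases "i \<in> G")
    case False
    then show ?thesis using that w m_outside[of i] by (auto simp: vanishing_weights_def)
  next
    case True
    then have l: "0 < l i" "l i < 1" "c i \<noteq> 0" by (auto simp: G_def)
    show ?thesis
    proof (cases "c i > 0")
      case True
      then have "t * c i \<le> 1 - l i"
        using tle[OF \<open>i \<in> G\<close>] by (simp add: h_def field_simps)
      moreover have "0 \<le> t * c i" using True tpos by simp
      ultimately show ?thesis using l by (simp add: m_def)
    next
      case False
      then have "c i < 0" using l by simp
      then have "t * (- c i) \<le> l i"
        using tle[OF \<open>i \<in> G\<close>] False
        by (simp add: h_def pos_le_divide_eq del: mult_minus_right divide_minus_right)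
      moreover have "t * c i \<le> 0" using \<open>c i < 0\<close> tpos by (simp add: mult_le_0_iff)
      ultimately show ?thesis using l by (simp add: m_def)
    qed
  qed
  obtain j where j: "j \<in> G" "t = h j" using t_in by auto
  have mj: "m j = 0 \<or> m j = 1"
    using j by (auto simp: m_def h_def G_def)
  have "{i\<in>I. 0 < m i \<and> m i < 1} \<subseteq> ?F - {j}"
  proof
    fix i assume i: "i \<in> {i\<in>I. 0 < m i \<and> m i < 1}"
    then have "i \<in> ?F"
      using m_outside[of i] G_sub by (cases "i \<in> G") auto
    moreover have "i \<noteq> j" using i mj by auto
    ultimately show "i \<in> ?F - {j}" by blast
  qed
  moreover have "j \<in> ?F" using j by (auto simp: G_def)
  ultimately have "{i\<in>I. 0 < m i \<and> m i < 1} \<subset> ?F" by blast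
  then have "card {i\<in>I. 0 < m i \<and> m i < 1} < card ?F" using finF by (rule psubset_card_mono[rotated])
  moreover have "(\<Sum>i\<in>I. m i *\<^sub>R f i) = 0"
  proof -
    have "(\<Sum>i\<in>I. m i *\<^sub>R f i) = (\<Sum>i\<in>I. l i *\<^sub>R f i) + t *\<^sub>R (\<Sum>i\<in>I. c i *\<^sub>R f i)"
      by (simp add: m_def scaleR_add_left sum.distrib scaleR_right.sum)
    then show ?thesis using cf w by (simp add: vanishing_weights_def)
  qed
  moreover have "(\<Sum>i\<in>I. m i) = s"
    using cs w by (simp add: m_def sum.distrib vanishing_weights_def flip: sum_distrib_left)
  ultimately show ?thesis using m_range by (auto simp: vanishing_weights_def)
qed

lemma few_fractional:
  fixes f :: "'i \<Rightarrow> 'a::euclidean_space"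
  assumes "finite I" "vanishing_weights I f l s"
  obtains m where "vanishing_weights I f m s" "card {i\<in>I. 0 < m i \<and> m i < 1} \<le> Suc DIM('a)"
  using assms(2)
proof (induction "card {i\<in>I. 0 < l i \<and> l i < 1}" arbitrary: l thesis rule: less_induct)
  case less
  show ?case
  proof (cases "card {i\<in>I. 0 < l i \<and> l i < 1} \<le> Suc DIM('a)")
    case True
    with less.prems show ?thesis by blast
  next
    case False
    then obtain m where "vanishing_weights I f m s"
      "card {i\<in>I. 0 < m i \<and> m i < 1} < card {i\<in>I. 0 < l i \<and> l i < 1}"
      using reduce_fractional[OF assms(1) less.prems(2)] by auto
    with less.hyps less.prems(1) show ?thesis by blast
  qed
qed

lemma remove_one:
  fixes f :: "'i \<Rightarrow> 'a::euclidean_space"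
  assumes fin: "finite I" and card: "card I = DIM('a) + Suc n"
    and w: "vanishing_weights I f l (real (Suc n))"
  obtains i m where "i \<in> I" "vanishing_weights (I - {i}) f m (real n)"
proof -
  have "vanishing_weights I f (\<lambda>i. real n / real (Suc n) * l i) (real n)"
    using vanishing_weights_scale[OF w, of "real n / real (Suc n)"] by simp
  then obtain m where m: "vanishing_weights I f m (real n)"
      and few: "card {i\<in>I. 0 < m i \<and> m i < 1} \<le> Suc DIM('a)"
    using few_fractional[OF fin] by blast
  have "\<exists>i\<in>I. m i = 0"
  proof (rule ccontr)
    assume nz: "\<not> (\<exists>i\<in>I. m i = 0)"
    let ?F = "{i\<in>I. 0 < m i \<and> m i < 1}"
    have one: "m i = 1" if "i \<in> I - ?F" for i
      using that nz m unfolding vanishing_weights_def by force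
    have "real n = (\<Sum>i\<in>I - ?F. m i) + (\<Sum>i\<in>?F. m i)"
      using m fin by (subst sum.subset_diff[symmetric]) (auto simp: vanishing_weights_def)
    also have "(\<Sum>i\<in>I - ?F. m i) = real (card (I - ?F))"
      using sum.cong[OF refl one, of "I - ?F"] by simp
    finally have eq: "real n = real (card (I - ?F)) + (\<Sum>i\<in>?F. m i)" .
    have c: "card (I - ?F) + card ?F = DIM('a) + Suc n"
      using card_Diff_subset[of ?F I] card_mono[of I ?F] fin card by simp
    show False
    proof (cases "?F = {}")
      case True
      with eq c show ?thesis by simp
    next
      case False
      then have "(\<Sum>i\<in>?F. m i) > 0" using fin by (intro sum_pos) auto
      then have "real (card (I - ?F)) < real n" using eq by simp
      with c few show ?thesis by simp
    qed
  qed
  then obtain i where i: "i \<in> I" "m i = 0" by blast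
  have "vanishing_weights (I - {i}) f m (real n)"
    using m i fin by (auto simp: vanishing_weights_def sum.remove[OF fin i(1)])
  with i(1) show ?thesis by (rule that)
qed

text \<open>Subtracting the vanishing combination leaves the coefficients \<open>1 - l i\<close>,
  which are nonnegative and add up to the dimension.\<close>

lemma norm_sum_le_dim:
  fixes f :: "'i \<Rightarrow> 'a::euclidean_space"
  assumes w: "vanishing_weights I f l (real n)" and "card I = DIM('a) + n"
    and b: "\<And>i. i \<in> I \<Longrightarrow> norm (f i) \<le> 1"
  shows "norm (\<Sum>i\<in>I. f i) \<le> real DIM('a)"
proof -
  have "(\<Sum>i\<in>I. f i) = (\<Sum>i\<in>I. (1 - l i) *\<^sub>R f i)"
    using w by (simp add: vanishing_weights_def scaleR_diff_left sum_subtractf)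
  also have "norm \<dots> \<le> (\<Sum>i\<in>I. (1 - l i))"
    using w b by (intro sum_norm_le) (auto simp: vanishing_weights_def intro: mult_left_le)
  also have "\<dots> = real DIM('a)"
    using w assms(2) by (simp add: sum_subtractf vanishing_weights_def)
  finally show ?thesis .
qed

lemma norm_sum_list_le_length:
  fixes f :: "'i \<Rightarrow> 'a::real_normed_vector"
  assumes "\<And>i. i \<in> set xs \<Longrightarrow> norm (f i) \<le> 1"
  shows "norm (sum_list (map f xs)) \<le> real (length xs)"
  using assms
proof (induction xs)
  case (Cons x xs)
  then have "norm (f x) \<le> 1" "norm (sum_list (map f xs)) \<le> real (length xs)" by auto
  then show ?case using norm_triangle_ineq[of "f x" "sum_list (map f xs)"] by simp
qed simp

text \<open>The order is built from the back: the index freed by \<open>remove_one\<close> goes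
  last, the weights bound the full sum, and the induction hypothesis bounds the shorter prefixes. At
  \<open>n = 0\<close> there are only as many vectors as dimensions, and the triangle inequality
  suffices.\<close>

lemma steinitz_weights:
  fixes f :: "'i \<Rightarrow> 'a::euclidean_space"
  assumes "finite I" "card I = DIM('a) + n" "vanishing_weights I f l (real n)"
    and "\<And>i. i \<in> I \<Longrightarrow> norm (f i) \<le> 1"
  shows "\<exists>xs. distinct xs \<and> set xs = I \<and>
    (\<forall>k. norm (sum_list (map f (take k xs))) \<le> real DIM('a))"
  using assms
proof (induction n arbitrary: I l)
  case 0
  obtain xs where xs: "set xs = I" "distinct xs" using finite_distinct_list[OF 0(1)] by blast
  have len: "length xs = DIM('a)" using xs 0(2) distinct_card by fastforce
  have "norm (sum_list (map f (take k xs))) \<le> real DIM('a)" for k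
  proof -
    have "norm (sum_list (map f (take k xs))) \<le> real (length (take k xs))"
      using 0(4) xs(1) by (intro norm_sum_list_le_length) (auto dest: in_set_takeD)
    also have "\<dots> \<le> real DIM('a)" using len by simp
    finally show ?thesis .
  qed
  with xs show ?case by blast
next
  case (Suc n)
  obtain i m where i: "i \<in> I" and m: "vanishing_weights (I - {i}) f m (real n)"
    using remove_one[OF Suc.prems(1-3)] by blast
  have "\<exists>xs. distinct xs \<and> set xs = I - {i} \<and>
      (\<forall>k. norm (sum_list (map f (take k xs))) \<le> real DIM('a))"
    using Suc.prems i by (intro Suc.IH[OF _ _ m]) auto
  then obtain xs where xs: "distinct xs" "set xs = I - {i}"
      "\<And>k. norm (sum_list (map f (take k xs))) \<le> real DIM('a)"
    by blast
  have d: "distinct (xs @ [i])" "set (xs @ [i]) = I" using xs i by auto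
  have "norm (sum_list (map f (take k (xs @ [i])))) \<le> real DIM('a)" for k
  proof (cases "k \<le> length xs")
    case True
    with xs(3)[of k] show ?thesis by simp
  next
    case False
    then have "take k (xs @ [i]) = xs @ [i]" by simp
    then have "sum_list (map f (take k (xs @ [i]))) = (\<Sum>i\<in>I. f i)"
      using sum_list_distinct_conv_sum_set[OF d(1), of f] d(2) by simp
    also have "norm \<dots> \<le> real DIM('a)" by (rule norm_sum_le_dim[OF Suc.prems(3,2,4)])
    finally show ?thesis .
  qed
  with d show ?case by blast
qed

text \<open>As the sum is zero, constant weights are vanishing; scaled to the right mass they start
  the induction. For fewer vectors than dimensions the triangle inequality is enough.\<close>

lemma steinitz_family:
  fixes f :: "'i \<Rightarrow> 'a::euclidean_space"
  assumes fin: "finite I" and sum0: "(\<Sum>i\<in>I. f i) = 0" and b: "\<And>i. i \<in> I \<Longrightarrow> norm (f i) \<le> 1"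
  shows "\<exists>xs. distinct xs \<and> set xs = I \<and>
    (\<forall>k. norm (sum_list (map f (take k xs))) \<le> real DIM('a))"
proof (cases "card I \<ge> DIM('a)")
  case True
  define n where "n = card I - DIM('a)"
  have card: "card I = DIM('a) + n" using True by (simp add: n_def)
  then have pos: "card I > 0" by simp
  define a where "a = real n / real (card I)"
  have "vanishing_weights I f (\<lambda>_. 1) (real (card I))"
    using sum0 by (simp add: vanishing_weights_def)
  from vanishing_weights_scale[OF this, of a]
  have "vanishing_weights I f (\<lambda>_. a * 1) (real n)"
    using card pos by (auto simp: a_def)
  from steinitz_weights[OF fin card this b] show ?thesis by simp
next
  case False
  obtain xs where xs: "set xs = I" "distinct xs" using finite_distinct_list[OF fin] by blast
  have len: "length xs \<le> DIM('a)" using xs False distinct_card by fastforce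
  have "norm (sum_list (map f (take k xs))) \<le> real DIM('a)" for k
  proof -
    have "norm (sum_list (map f (take k xs))) \<le> real (length (take k xs))"
      using b xs(1) by (intro norm_sum_list_le_length) (auto dest: in_set_takeD)
    also have "\<dots> \<le> real DIM('a)" using len by simp
    finally show ?thesis .
  qed
  with xs show ?thesis by blast
qed

text \<open>Positions in a listing serve as indices, so repeated vectors stay distinct; division by
  \<open>R\<close> reduces to the unit ball.\<close>

lemma steinitz_multiset:
  fixes V :: "'a::euclidean_space multiset"
  assumes "sum_mset V = 0" "\<And>v. v \<in># V \<Longrightarrow> norm v \<le> R" "R > 0"
  shows "\<exists>vs. mset vs = V \<and> (\<forall>k. norm (sum_list (take k vs)) \<le> R * real DIM('a))"
proof -
  obtain us where us: "mset us = V" using ex_mset by blast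
  define f where "f = (\<lambda>i. (1 / R) *\<^sub>R us ! i)"
  have "(\<Sum>i<length us. us ! i) = 0"
    using assms(1) sum_mset_sum_list[of us] us
    by (simp add: sum_list_sum_nth atLeast0LessThan)
  then have "(\<Sum>i<length us. f i) = 0"
    by (simp add: f_def flip: scaleR_right.sum)
  moreover have "norm (f i) \<le> 1" if "i \<in> {..<length us}" for i
  proof -
    have "us ! i \<in># V" using that us by auto
    then show ?thesis using assms(2,3) by (auto simp: f_def field_simps)
  qed
  ultimately obtain xs where xs: "distinct xs" "set xs = {..<length us}"
      "\<And>k. norm (sum_list (map f (take k xs))) \<le> real DIM('a)"
    using steinitz_family[of "{..<length us}" f] by auto
  define vs where "vs = map ((!) us) xs"
  have "mset xs = mset [0..<length us]"
    using xs by (subst set_eq_iff_mset_eq_distinct[symmetric]) (auto simp: atLeast0LessThan)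
  then have "mset vs = mset (map ((!) us) [0..<length us])" by (simp only: vs_def mset_map)
  then have "mset vs = V" using us by (simp add: map_nth)
  moreover have "norm (sum_list (take k vs)) \<le> R * real DIM('a)" for k
  proof -
    have "sum_list (map f ys) = (1 / R) *\<^sub>R sum_list (map ((!) us) ys)" for ys
      by (induction ys) (auto simp: f_def scaleR_add_right)
    then have "norm (sum_list (take k vs)) / R \<le> real DIM('a)"
      using xs(3)[of k] assms(3) by (simp add: vs_def take_map)
    then show ?thesis using assms(3) by (simp add: field_simps)
  qed
  ultimately show ?thesis by blast
qed

section \<open>Least bounds over orderings\<close>

text \<open>\<open>LEAST\<close> over the reals is informative only if a minimum exists. Upward
  closure puts everything above the infimum into \<open>P\<close>, and \<open>limit\<close> then
  adds the infimum itself.\<close>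

lemma least_real_bound:
  fixes P :: "real \<Rightarrow> bool"
  assumes "P C0" and nonneg: "\<And>C. P C \<Longrightarrow> 0 \<le> C"
    and mono: "\<And>C D. P C \<Longrightarrow> C \<le> D \<Longrightarrow> P D"
    and limit: "\<And>c. (\<And>C. c < C \<Longrightarrow> P C) \<Longrightarrow> P c"
  shows "P (LEAST C. P C)" "\<And>C. P C \<Longrightarrow> (LEAST C. P C) \<le> C"
proof -
  define m where "m = Inf {C. P C}"
  have bdd: "bdd_below {C. P C}" using nonneg by (intro bdd_belowI[of _ 0]) auto
  have le: "m \<le> C" if "P C" for C unfolding m_def using that bdd by (intro cInf_lower) auto
  have "P C" if "m < C" for C
    using that mono assms(1) bdd cInf_less_iff[of "{C. P C}" C] unfolding m_def
    by (metis empty_iff less_imp_le mem_Collect_eq)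
  then have "P m" by (rule limit)
  then have eq: "(LEAST C. P C) = m" using le by (intro Least_equality) auto
  show "P (LEAST C. P C)" "\<And>C. P C \<Longrightarrow> (LEAST C. P C) \<le> C" using eq le \<open>P m\<close> by auto
qed

text \<open>A multiset has only finitely many orderings, so the best bound is attained.\<close>

lemma ordering_bound_limit:
  fixes g :: "'a list \<Rightarrow> nat \<Rightarrow> real"
  assumes "\<And>C. c < C \<Longrightarrow> \<exists>vs. mset vs = V \<and> (\<forall>k\<in>{1..length vs}. g vs k \<le> C)"
  shows "\<exists>vs. mset vs = V \<and> (\<forall>k\<in>{1..length vs}. g vs k \<le> c)"
proof -
  \<comment> \<open>\<open>A\<close> holds the values above \<open>c\<close> that occur in any
    ordering. It is finite, so some \<open>C > c\<close> lies below all of it, and an ordering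
    bounded by \<open>C\<close> is already bounded by \<open>c\<close>.\<close>
  define A where "A = {x. x > c \<and> (\<exists>vs. mset vs = V \<and> (\<exists>k\<in>{1..length vs}. x = g vs k))}"
  have "finite (\<Union>vs\<in>{vs. mset vs = V}. g vs ` {1..length vs})"
  proof (intro finite_UN_I)
    obtain us where "mset us = V" using ex_mset by blast
    then show "finite {vs. mset vs = V}" using mset_eq_finite[of us] by simp
  qed auto
  then have fin: "finite A" by (rule finite_subset[rotated]) (auto simp: A_def)
  obtain C where C: "c < C" "\<And>x. x \<in> A \<Longrightarrow> C < x"
  proof (cases "A = {}")
    case True
    then show ?thesis using that[of "c + 1"] by simp
  next
    case False
    then have "Min A > c" using fin Min_in[OF fin] by (auto simp: A_def)
    then obtain C where "c < C" "C < Min A" using dense by blast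
    then show ?thesis using that fin False by (meson Min_le order_less_le_trans)
  qed
  obtain vs where vs: "mset vs = V" "\<forall>k\<in>{1..length vs}. g vs k \<le> C" using assms[OF C(1)] by blast
  have "g vs k \<le> c" if "k \<in> {1..length vs}" for k
  proof (rule ccontr)
    assume "\<not> g vs k \<le> c"
    then have "g vs k \<in> A" using vs(1) that unfolding A_def by force
    with C(2) vs(2) that show False by fastforce
  qed
  with vs(1) show ?thesis by blast
qed

section \<open>The asymmetric norm of a convex body\<close>

locale norm_body =
  fixes B :: "(real ^ 'd) set"
  assumes body: "convex_body B" and zero_interior: "0 \<in> interior B"
begin

abbreviation N where "N \<equiv> body_norm B"

lemma compact_B: "compact B" and convex_B: "convex B"
  using body by (auto simp: convex_body_def)

lemma zero_in: "0 \<in> B" using zero_interior interior_subset by blast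

lemma N_le: "0 \<le> r \<Longrightarrow> y \<in> B \<Longrightarrow> N (r *\<^sub>R y) \<le> r"
  unfolding body_norm_def by (intro cInf_lower bdd_belowI[of _ 0]) auto

lemma N_le_norm: "\<exists>e>0. \<forall>x. N x \<le> norm x / e"
proof -
  obtain e where e: "e > 0" "cball 0 e \<subseteq> B"
    using zero_interior mem_interior_cball by blast
  have "N x \<le> norm x / e" for x
  proof (cases "x = 0")
    case True
    then show ?thesis using N_le[of 0 0] zero_in by simp
  next
    case False
    have "N ((norm x / e) *\<^sub>R ((e / norm x) *\<^sub>R x)) \<le> norm x / e"
      using False e by (intro N_le subsetD[OF e(2)]) auto
    then show ?thesis using False e by simp
  qed
  with e(1) show ?thesis by blast
qed

text \<open>A ball about the origin inside \<open>B\<close> absorbs every vector, so the infimum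
  defining the norm is taken over a nonempty set.\<close>

lemma norm_set_nonempty: "{r. r \<ge> 0 \<and> x \<in> (\<lambda>y. r *\<^sub>R y) ` B} \<noteq> {}"
proof -
  obtain e where e: "e > 0" "cball 0 e \<subseteq> B"
    using zero_interior mem_interior_cball by blast
  define r where "r = norm x / e + 1"
  have r: "r > 0" using e by (simp add: r_def add_nonneg_pos)
  have "norm x \<le> r * e" using e by (simp add: r_def field_simps)
  then have "norm x / r \<le> e" using r by (simp add: pos_divide_le_eq mult.commute)
  then have "(1 / r) *\<^sub>R x \<in> B" using r by (intro subsetD[OF e(2)]) simp
  moreover have "x = r *\<^sub>R ((1 / r) *\<^sub>R x)" using r by simp
  ultimately show ?thesis using r by (metis (mono_tags, lifting) empty_iff image_eqI less_imp_le mem_Collect_eq)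
qed

lemma N_greatest:
  assumes "\<And>r y. 0 \<le> r \<Longrightarrow> y \<in> B \<Longrightarrow> x = r *\<^sub>R y \<Longrightarrow> c \<le> r"
  shows "c \<le> N x"
  unfolding body_norm_def using assms by (intro cInf_greatest norm_set_nonempty) auto

lemma N_approx:
  assumes "N x < c"
  obtains r y where "0 \<le> r" "r < c" "y \<in> B" "x = r *\<^sub>R y"
  using assms cInf_lessD[OF norm_set_nonempty[of x], of c] unfolding body_norm_def by blast

lemma N_nonneg: "0 \<le> N x"
  by (rule N_greatest)

lemma N_zero [simp]: "N 0 = 0"
  using N_le[of 0 0] zero_in N_nonneg[of 0] by simp

lemma N_le_one: "x \<in> B \<Longrightarrow> N x \<le> 1"
  using N_le[of 1 x] by simp

lemma N_scale_le:
  assumes "0 < a" shows "a * N x \<le> N (a *\<^sub>R x)"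
proof (rule N_greatest)
  fix r y assume *: "0 \<le> r" "y \<in> B" "a *\<^sub>R x = r *\<^sub>R y"
  have "x = (1 / a) *\<^sub>R (a *\<^sub>R x)" using assms by simp
  also have "\<dots> = (r / a) *\<^sub>R y" unfolding *(3) by simp
  finally have "x = (r / a) *\<^sub>R y" .
  then have "N x \<le> r / a" using N_le[of "r / a" y] * assms by simp
  then show "a * N x \<le> r" using assms by (simp add: field_simps)
qed

lemma N_scale: "0 \<le> a \<Longrightarrow> N (a *\<^sub>R x) = a * N x"
proof (cases "a = 0")
  case False
  assume "0 \<le> a"
  with False have a: "a > 0" by simp
  have "(1 / a) * N (a *\<^sub>R x) \<le> N x"
    using N_scale_le[of "1 / a" "a *\<^sub>R x"] a by simp
  then have "N (a *\<^sub>R x) \<le> a * N x" using a by (simp add: field_simps)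
  with N_scale_le[OF a] show ?thesis by (simp add: antisym)
qed simp

text \<open>By convexity, if \<open>x\<close> is in \<open>r B\<close> and \<open>y\<close> in
  \<open>s B\<close>, then \<open>x + y\<close> is in \<open>(r + s) B\<close>. Near-optimal
  \<open>r\<close> and \<open>s\<close> suffice, so attainment of the infimum is not at
  issue.\<close>

lemma N_triangle: "N (x + y) \<le> N x + N y"
proof (rule field_le_epsilon)
  fix e :: real assume e: "0 < e"
  obtain r u where u: "0 \<le> r" "r < N x + e / 2" "u \<in> B" "x = r *\<^sub>R u"
    using N_approx[of x "N x + e / 2"] e by auto
  obtain s v where v: "0 \<le> s" "s < N y + e / 2" "v \<in> B" "y = s *\<^sub>R v"
    using N_approx[of y "N y + e / 2"] e by auto
  have "N (x + y) \<le> r + s"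
  proof (cases "r + s = 0")
    case True
    then show ?thesis using u v by (simp add: add_nonneg_eq_0_iff)
  next
    case False
    let ?w = "(r / (r + s)) *\<^sub>R u + (s / (r + s)) *\<^sub>R v"
    have "?w \<in> B"
      using False u v by (intro convexD[OF convex_B]) (auto simp flip: add_divide_distrib)
    moreover have "x + y = (r + s) *\<^sub>R ?w" using False u v by (simp add: scaleR_add_right)
    ultimately show ?thesis using N_le[of "r + s" ?w] u v by simp
  qed
  also have "\<dots> \<le> N x + N y + e" using u v by simp
  finally show "N (x + y) \<le> N x + N y + e" .
qed

lemma norm_le_N: "\<exists>R>0. \<forall>x. norm x \<le> R * N x"
proof -
  obtain R where R: "R > 0" "\<And>x. x \<in> B \<Longrightarrow> norm x \<le> R"
    using compact_imp_bounded[OF compact_B] bounded_pos by blast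
  have "norm x / R \<le> N x" for x
  proof (rule N_greatest)
    fix r y assume *: "0 \<le> r" "y \<in> B" "x = r *\<^sub>R y"
    then have "norm x \<le> r * R" using R by (auto intro!: mult_left_mono)
    then show "norm x / R \<le> r" using R by (simp add: field_simps)
  qed
  then have "norm x \<le> R * N x" for x using R by (simp add: field_simps)
  with R(1) show ?thesis by blast
qed

text \<open>Supplies a test vector that is admissible for the relaxed constant whatever the value of
  \<open>\<epsilon> \<ge> 0\<close>.\<close>

lemma exists_N_one: "\<exists>x. N x = 1"
proof -
  obtain R where R: "R > 0" "\<And>x. norm x \<le> R * N x" using norm_le_N by blast
  define x :: "real ^ 'd" where "x = axis undefined 1"
  have "norm x > 0" by (simp add: x_def)
  then have pos: "N x > 0"
    using R(2)[of x] N_nonneg[of x] by (cases "N x = 0") auto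
  then have "N ((1 / N x) *\<^sub>R x) = 1" by (subst N_scale) auto
  then show ?thesis ..
qed

text \<open>The triangle inequality bounds \<open>N x - N y\<close> by a multiple of the distance;
  exchanging \<open>x\<close> and \<open>y\<close> gives the Lipschitz property although the norm
  may be asymmetric.\<close>

lemma continuous_N: "continuous_on S N"
proof -
  obtain e where e: "e > 0" "\<And>x. N x \<le> norm x / e" using N_le_norm by blast
  have "N x - N y \<le> 1 / e * dist x y" for x y
    using N_triangle[of y "x - y"] e(2)[of "x - y"] by (simp add: dist_norm)
  then have "dist (N x) (N y) \<le> 1 / e * dist x y" for x y
    by (metis abs_le_iff dist_commute dist_real_def minus_diff_eq)
  then have "(1 / e)-lipschitz_on S N" using e(1) by (intro lipschitz_onI) auto
  then show ?thesis by (rule lipschitz_on_continuous_on)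
qed

text \<open>Continuity and compactness provide a maximiser, so \<open>GREATEST\<close> is a true
  maximum.\<close>

lemma asymmetry_upper: "v \<in> B \<Longrightarrow> N (- v) \<le> asymmetry B"
proof -
  have "continuous_on B (\<lambda>v. N (- v))"
    by (rule continuous_on_compose2[OF continuous_N]) (auto intro: continuous_intros)
  then obtain w where w: "w \<in> B" "\<And>v. v \<in> B \<Longrightarrow> N (- v) \<le> N (- w)"
    using continuous_attains_sup[OF compact_B] zero_in by blast
  then have "asymmetry B = N (- w)"
    unfolding asymmetry_def by (intro Greatest_equality) auto
  then show "v \<in> B \<Longrightarrow> N (- v) \<le> asymmetry B" using w(2) by simp
qed

lemma asymmetry_nonneg: "0 \<le> asymmetry B"
  using asymmetry_upper[OF zero_in] by simp

lemma N_minus: "N (- x) \<le> asymmetry B * N x"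
proof -
  have le: "N (- x) \<le> asymmetry B * r" if "0 \<le> r" "y \<in> B" "x = r *\<^sub>R y" for r y
  proof -
    have "N (- x) = r * N (- y)" using that N_scale[of r "- y"] by simp
    then show ?thesis using that asymmetry_upper[of y] by (simp add: mult.commute[of _ r] mult_left_mono)
  qed
  show ?thesis
  \<comment> \<open>The nonzero case divides by the asymmetry before passing to the infimum over
    representations of \<open>x\<close>.\<close>
  proof (cases "asymmetry B = 0")
    case True
    obtain r y where "0 \<le> r" "y \<in> B" "x = r *\<^sub>R y" by (rule N_approx[of x "N x + 1"]) auto
    with le True show ?thesis by fastforce
  next
    case False
    then have "N (- x) / asymmetry B \<le> N x"
      using le asymmetry_nonneg by (intro N_greatest) (simp add: divide_le_eq mult.commute)
    then show ?thesis using False asymmetry_nonneg by (simp add: divide_le_eq mult.commute)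
  qed
qed

section \<open>Both constants are attained\<close>

lemma N_steinitz_finite:
  obtains C where "\<And>V. sum_mset V = 0 \<Longrightarrow> (\<And>v. v \<in># V \<Longrightarrow> norm v \<le> R) \<Longrightarrow>
    \<exists>vs. mset vs = V \<and> (\<forall>k. N (sum_list (take k vs)) \<le> C)"
proof -
  obtain e where e: "e > 0" "\<And>x. N x \<le> norm x / e" using N_le_norm by blast
  \<comment> \<open>The maximum with 1 provides the positive radius that
    \<open>steinitz_multiset\<close> requires.\<close>
  define R' where "R' = max R 1"
  have *: "N x \<le> R' * real DIM(real ^ 'd) / e" if "norm x \<le> R' * real DIM(real ^ 'd)" for x
    by (rule order_trans[OF e(2) divide_right_mono[OF that]]) (use e in simp)
  show ?thesis
  proof (rule that)
    fix V :: "(real ^ 'd) multiset"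
    assume V: "sum_mset V = 0" "\<And>v. v \<in># V \<Longrightarrow> norm v \<le> R"
    then have "norm v \<le> R'" if "v \<in># V" for v using that by (force simp: R'_def)
    then have "\<exists>vs. mset vs = V \<and> (\<forall>k. norm (sum_list (take k vs)) \<le> R' * real DIM(real ^ 'd))"
      by (intro steinitz_multiset V(1)) (auto simp: R'_def)
    then show "\<exists>vs. mset vs = V \<and>
        (\<forall>k. N (sum_list (take k vs)) \<le> R' * real DIM(real ^ 'd) / e)"
      using * by blast
  qed
qed

text \<open>The given bound itself shows that bounds exist, so only the closure properties of
  \<open>least_real_bound\<close> have to be checked.\<close>

lemma steinitz_const_least:
  assumes "steinitz_bound B C" shows "steinitz_const B \<le> C"
  unfolding steinitz_const_def
proof (rule least_real_bound(2)[where P = "steinitz_bound B", OF assms _ _ _ assms])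
  fix C assume "steinitz_bound B C"
  \<comment> \<open>The family of a single zero vector is admissible, and its only partial sum has
    norm 0.\<close>
  then obtain vs where "mset vs = {#0#}"
      "\<forall>k\<in>{1..length vs}. N (sum_list (take k vs)) \<le> C"
    unfolding steinitz_bound_def using zero_in by (auto dest!: spec[of _ "{#0#}"])
  then show "0 \<le> C" by (auto dest: bspec[of _ _ 1])
next
  fix C D :: real assume "steinitz_bound B C" "C \<le> D"
  then show "steinitz_bound B D" unfolding steinitz_bound_def by (meson order_trans)
next
  fix c :: real assume lim: "\<And>C. c < C \<Longrightarrow> steinitz_bound B C"
  show "steinitz_bound B c"
    unfolding steinitz_bound_def
  proof (intro allI impI)
    fix V assume V: "set_mset V \<subseteq> B \<and> sum_mset V = 0"
    have "\<exists>vs. mset vs = V \<and> (\<forall>k\<in>{1..length vs}. N (sum_list (take k vs)) \<le> C)" if "c < C" for C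
      using lim[OF that] V unfolding steinitz_bound_def by blast
    then show "\<exists>vs. mset vs = V \<and> (\<forall>k\<in>{1..length vs}. N (sum_list (take k vs)) \<le> c)"
      by (rule ordering_bound_limit)
  qed
qed

lemma relaxed_steinitz_bound_nonneg:
  assumes "relaxed_steinitz_bound \<epsilon> B C" "0 \<le> \<epsilon>" shows "0 \<le> C"
proof -
  obtain x where "N x = 1" using exists_N_one ..
  then obtain vs where vs: "mset vs = {#x#}"
      "\<forall>k\<in>{1..length vs}. N (sum_list (take k vs) - (real k / real (length vs)) *\<^sub>R x) \<le> C"
    using assms unfolding relaxed_steinitz_bound_def by (auto dest!: spec[of _ "{#x#}"])
  then have "vs = [x]" by simp
  with vs(2) show ?thesis by simp
qed

text \<open>Subtracting the mean \<open>a\<close> gives a family with sum zero and Euclidean norms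
  at most \<open>2 * R\<close>. Shifting a good ordering of it back adds \<open>k a\<close> to the
  k-th partial sum, which is exactly the linear term that the relaxed bound subtracts.\<close>

lemma relaxed_steinitz_finite: "\<exists>C. relaxed_steinitz_bound \<epsilon> B C"
proof -
  obtain R where R: "R > 0" "\<And>x. norm x \<le> R * N x" using norm_le_N by blast
  obtain C where C: "\<And>V. sum_mset V = 0 \<Longrightarrow> (\<And>v. v \<in># V \<Longrightarrow> norm v \<le> 2 * R) \<Longrightarrow>
      \<exists>vs. mset vs = V \<and> (\<forall>k. N (sum_list (take k vs)) \<le> C)"
    using N_steinitz_finite by blast
  have "relaxed_steinitz_bound \<epsilon> B C"
    unfolding relaxed_steinitz_bound_def
  proof (intro allI impI)
    fix V assume V: "\<forall>v\<in>#V. 1 - \<epsilon> \<le> N v \<and> N v \<le> 1"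
    have le: "norm v \<le> R" if "v \<in># V" for v
      using V that R(1) by (intro order_trans[OF R(2)]) (auto intro: mult_left_le)
    define a where "a = (1 / real (size V)) *\<^sub>R sum_mset V"
    have "norm (sum_mset V) \<le> real (size V) * R"
      using le
    proof (induction V)
      case (add x V)
      then have "norm x \<le> R" "norm (sum_mset V) \<le> real (size V) * R" by auto
      then show ?case using norm_triangle_ineq[of x "sum_mset V"] by (simp add: algebra_simps)
    qed simp
    then have a: "norm a \<le> R" using R(1) 
      by (cases "V = {#}") (auto simp: a_def divide_le_eq mult.commute)
    have sz: "real (size V) *\<^sub>R a = sum_mset V" by (cases "V = {#}") (auto simp: a_def)
    have sub: "sum_mset (image_mset (\<lambda>v. v - a) W) = sum_mset W - real (size W) *\<^sub>R a" for W
      by (induction W) (auto simp: algebra_simps)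
    obtain ws where ws: "mset ws = image_mset (\<lambda>v. v - a) V"
        "\<And>k. N (sum_list (take k ws)) \<le> C"
    proof -
      have "sum_mset (image_mset (\<lambda>v. v - a) V) = 0" by (simp add: sub sz)
      moreover have "norm w \<le> 2 * R" if "w \<in># image_mset (\<lambda>v. v - a) V" for w
        using that le a by (force intro: order_trans[OF norm_triangle_ineq4])
      ultimately show ?thesis using C that by blast
    qed
    define vs where "vs = map (\<lambda>w. w + a) ws"
    have vs: "mset vs = V" by (simp add: vs_def ws(1) multiset.map_comp comp_def)
    have "N (sum_list (take k vs) - (real k / real (length vs)) *\<^sub>R sum_mset V) \<le> C"
      if "k \<in> {1..length vs}" for k
    proof -
      have shift: "sum_list (map (\<lambda>w. w + a) us) = sum_list us + real (length us) *\<^sub>R a" for us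
        by (induction us) (auto simp: algebra_simps)
      have "k \<le> length ws" using that by (simp add: vs_def)
      then have "sum_list (take k vs) = sum_list (take k ws) + real k *\<^sub>R a"
        by (simp add: vs_def take_map shift)
      moreover have "length vs = size V" using vs by (metis size_mset)
      ultimately show ?thesis using ws(2)[of k] by (simp add: a_def)
    qed
    with vs show "\<exists>vs. mset vs = V \<and> (\<forall>k\<in>{1..length vs}.
        N (sum_list (take k vs) - (real k / real (length vs)) *\<^sub>R sum_mset V) \<le> C)"
      by blast
  qed
  then show ?thesis ..
qed

lemma relaxed_steinitz_const_bound:
  assumes "0 \<le> \<epsilon>" shows "relaxed_steinitz_bound \<epsilon> B (relaxed_steinitz_const \<epsilon> B)"
  unfolding relaxed_steinitz_const_def
proof -
  obtain C0 where "relaxed_steinitz_bound \<epsilon> B C0" using relaxed_steinitz_finite ..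
  then show "relaxed_steinitz_bound \<epsilon> B (LEAST C. relaxed_steinitz_bound \<epsilon> B C)"
  proof (rule least_real_bound(1))
    show "0 \<le> C" if "relaxed_steinitz_bound \<epsilon> B C" for C
      using relaxed_steinitz_bound_nonneg[OF that assms] .
  next
    fix C D :: real assume "relaxed_steinitz_bound \<epsilon> B C" "C \<le> D"
    then show "relaxed_steinitz_bound \<epsilon> B D"
      unfolding relaxed_steinitz_bound_def by (meson order_trans)
  next
    fix c :: real assume lim: "\<And>C. c < C \<Longrightarrow> relaxed_steinitz_bound \<epsilon> B C"
    show "relaxed_steinitz_bound \<epsilon> B c"
      unfolding relaxed_steinitz_bound_def
    proof (intro allI impI)
      fix V assume V: "\<forall>v\<in>#V. 1 - \<epsilon> \<le> N v \<and> N v \<le> 1"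
      have "\<exists>vs. mset vs = V \<and> (\<forall>k\<in>{1..length vs}.
          N (sum_list (take k vs) - (real k / real (length vs)) *\<^sub>R sum_mset V) \<le> C)"
        if "c < C" for C
        using lim[OF that] V unfolding relaxed_steinitz_bound_def by blast
      then show "\<exists>vs. mset vs = V \<and> (\<forall>k\<in>{1..length vs}.
          N (sum_list (take k vs) - (real k / real (length vs)) *\<^sub>R sum_mset V) \<le> c)"
        by (rule ordering_bound_limit)
    qed
  qed
qed

section \<open>Cutting into blocks\<close>

text \<open>\<open>bs\<close> are the closed blocks and \<open>rs\<close> the open one. A new vector
  joins \<open>rs\<close>, whose norm was at most \<open>t\<close>, so a block overshoots
  \<open>t\<close> by at most 1 when it is closed. The strict \<open>j < length b\<close> exempts
  the full block from the bound \<open>t\<close>.\<close>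

lemma greedy_blocks:
  assumes "0 \<le> t" "\<And>u. u \<in> set us \<Longrightarrow> N u \<le> 1"
  shows "\<exists>bs rs. us = concat bs @ rs \<and>
    (\<forall>b\<in>set bs. t \<le> N (sum_list b) \<and> N (sum_list b) \<le> t + 1 \<and>
       (\<forall>j<length b. N (sum_list (take j b)) \<le> t)) \<and>
    (\<forall>j. N (sum_list (take j rs)) \<le> t)"
  using assms(2)
proof (induction us rule: rev_induct)
  case Nil
  show ?case using assms(1) by (intro exI[of _ "[]"]) auto
next
  case (snoc u us)
  then have u: "N u \<le> 1" by simp
  have "\<exists>bs rs. us = concat bs @ rs \<and>
    (\<forall>b\<in>set bs. t \<le> N (sum_list b) \<and> N (sum_list b) \<le> t + 1 \<and>
       (\<forall>j<length b. N (sum_list (take j b)) \<le> t)) \<and>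
    (\<forall>j. N (sum_list (take j rs)) \<le> t)"
    using snoc.prems by (intro snoc.IH) auto
  then obtain bs rs where us: "us = concat bs @ rs"
    and bs: "\<forall>b\<in>set bs. t \<le> N (sum_list b) \<and> N (sum_list b) \<le> t + 1 \<and>
       (\<forall>j<length b. N (sum_list (take j b)) \<le> t)"
    and rs: "\<And>j. N (sum_list (take j rs)) \<le> t"
    by blast
  have prefix: "N (sum_list (take j (rs @ [u]))) \<le> t" if "j < length (rs @ [u])" for j
    using rs[of j] that by simp
  show ?case
  proof (cases "t \<le> N (sum_list (rs @ [u]))")
    case True
    have "N (sum_list (rs @ [u])) \<le> t + 1"
      using N_triangle[of "sum_list rs" u] rs[of "length rs"] u by simp
    with True prefix bs us show ?thesis
      using assms(1) by (intro exI[of _ "bs @ [rs @ [u]]"] exI[of _ "[]"]) auto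
  next
    case False
    then have "N (sum_list (take j (rs @ [u]))) \<le> t" for j
      using prefix[of j] by (cases "j < length (rs @ [u])") auto
    with bs us show ?thesis
      by (intro exI[of _ bs] exI[of _ "rs @ [u]"]) auto
  qed
qed

end

section \<open>Prefixes and rearrangements of lists of blocks\<close>

text \<open>Separates complete blocks from a proper prefix of the next one; \<open>j\<close> has to
  stay below the block length because the greedy bound \<open>t\<close> holds only there.\<close>

lemma take_concat_cases:
  obtains "take k (concat bs) = concat bs"
  | i j where "i < length bs" "j < length (bs ! i)"
      "take k (concat bs) = concat (take i bs) @ take j (bs ! i)"
proof (induction bs arbitrary: k thesis)
  case Nil
  then show ?case by simp
next
  case (Cons b bs)
  show ?case
  proof (cases "k < length b")
    case True
    then show ?thesis using Cons.prems(2)[of 0 k] by simp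
  next
    case False
    show ?thesis
    proof (rule Cons.IH[of "k - length b"])
      assume "take (k - length b) (concat bs) = concat bs"
      then show ?thesis using False Cons.prems(1) by simp
    next
      fix i j assume "i < length bs" "j < length (bs ! i)"
        "take (k - length b) (concat bs) = concat (take i bs) @ take j (bs ! i)"
      then show ?thesis using False Cons.prems(2)[of "Suc i" j] by simp
    qed
  qed
qed

text \<open>Lifts an ordering of block sums to an ordering of the blocks. As \<open>f\<close> may
  identify blocks, preimages are removed from \<open>M\<close> one at a time.\<close>

lemma reorder_preimage:
  assumes "mset ys = image_mset f M"
  obtains xs where "mset xs = M" "map f xs = ys"
  using assms
proof (induction ys arbitrary: M thesis)
  case Nil
  then show ?case by simp
next
  case (Cons y ys)
  then have "y \<in># image_mset f M" by (metis list.set_intros(1) set_mset_mset)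
  then obtain x where x: "x \<in># M" "y = f x" by auto
  then have "mset ys = image_mset f (M - {#x#})"
    using Cons.prems(2) by (simp add: image_mset_Diff flip: Cons.prems(2))
  then obtain xs where "mset xs = M - {#x#}" "map f xs = ys" using Cons.IH by blast
  with x show ?case by (intro Cons.prems(1)[of "x # xs"]) auto
qed

section \<open>From the relaxed constant to the Steinitz constant\<close>

context norm_body
begin

lemma steinitz_bound_from_relaxed:
  assumes eps: "0 < \<epsilon>" "\<epsilon> \<le> 1" and rel: "relaxed_steinitz_bound \<epsilon> B S"
  shows "steinitz_bound B ((S + (1 - \<epsilon>) * (asymmetry B + 1)) / \<epsilon>)"
  unfolding steinitz_bound_def
proof (intro allI impI)
  fix V assume V: "set_mset V \<subseteq> B \<and> sum_mset V = 0"
  define t where "t = (1 - \<epsilon>) / \<epsilon>"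
  have t: "0 \<le> t" "\<epsilon> * t = 1 - \<epsilon>" "\<epsilon> * (t + 1) = 1" using eps by (auto simp: t_def field_simps)
  have S: "0 \<le> S" using relaxed_steinitz_bound_nonneg[OF rel] eps by simp
  let ?\<rho> = "asymmetry B"
  \<comment> \<open>The three terms bound, in this order, the deviation of the block sums from
    linear growth, the linear growth itself, and a partial block.\<close>
  let ?C = "S / \<epsilon> + t * ?\<rho> + t"
  have C: "(S + (1 - \<epsilon>) * (?\<rho> + 1)) / \<epsilon> = ?C" using eps by (simp add: t_def field_simps)
  obtain us where us: "mset us = V" using ex_mset by blast
  have "N u \<le> 1" if "u \<in> set us" for u using that us V N_le_one by auto
  then obtain bs rs where cut: "us = concat bs @ rs"
    and bs: "\<And>b. b \<in> set bs \<Longrightarrow> t \<le> N (sum_list b) \<and> N (sum_list b) \<le> t + 1 \<and>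
       (\<forall>j<length b. N (sum_list (take j b)) \<le> t)"
    and rs: "\<And>j. N (sum_list (take j rs)) \<le> t"
    using greedy_blocks[OF t(1), of us] by metis
  let ?w = "\<lambda>b :: (real ^ 'd) list. \<epsilon> *\<^sub>R sum_list b"
  let ?W = "image_mset ?w (mset bs)"
  have "\<forall>w\<in>#?W. 1 - \<epsilon> \<le> N w \<and> N w \<le> 1"
  proof
    fix w assume "w \<in># ?W"
    then obtain b where b: "b \<in> set bs" "w = ?w b" by auto
    then have "\<epsilon> * t \<le> N w" "N w \<le> \<epsilon> * (t + 1)"
      using bs[of b] eps by (auto simp: N_scale)
    with t show "1 - \<epsilon> \<le> N w \<and> N w \<le> 1" by simp
  qed
  then obtain ws where ws: "mset ws = ?W"
    "\<And>k. k \<in> {1..length ws} \<Longrightarrow>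
       N (sum_list (take k ws) - (real k / real (length ws)) *\<^sub>R sum_mset ?W) \<le> S"
    using rel unfolding relaxed_steinitz_bound_def by blast
  obtain cs where cs: "mset cs = mset bs" "map ?w cs = ws" using reorder_preimage[OF ws(1)] .
  have set_cs: "set cs = set bs" using cs(1) by (metis set_mset_mset)
  have mset_concat: "mset (concat cs) = mset (concat bs)"
    using cs(1) by (metis mset_concat mset_map sum_mset_sum_list)
  define X where "X = sum_list (concat bs)"
  have scaled: "sum_list (map ?w ds) = \<epsilon> *\<^sub>R sum_list (concat ds)" for ds
    by (induction ds) (auto simp: scaleR_add_right)
  have X_cs: "sum_list (concat cs) = X"
    unfolding X_def using mset_concat by (metis sum_mset_sum_list)
  \<comment> \<open>The whole family sums to zero, so the closed blocks together cancel the
    remainder; the sign change is what brings in the asymmetry.\<close>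
  have X_rs: "X = - sum_list rs"
    using V us cut by (metis X_def eq_neg_iff_add_eq_0 sum_list_append sum_mset_sum_list)
  have N_X: "N X \<le> t * ?\<rho>"
  proof -
    have "N X \<le> ?\<rho> * N (sum_list rs)" unfolding X_rs by (rule N_minus)
    also have "\<dots> \<le> ?\<rho> * t" using rs[of "length rs"] asymmetry_nonneg by (intro mult_left_mono) auto
    finally show ?thesis by (simp add: mult.commute)
  qed
  have sum_W: "sum_mset ?W = \<epsilon> *\<^sub>R X"
    using scaled[of bs] by (simp add: X_def sum_mset_sum_list flip: mset_map)
  have nonneg: "0 \<le> S / \<epsilon>" "0 \<le> t * ?\<rho>" using S eps t asymmetry_nonneg by auto
  have block: "N (sum_list (concat (take i cs))) \<le> S / \<epsilon> + t * ?\<rho>" if "i < length cs" for i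
  \<comment> \<open>The relaxed bound speaks of nonempty prefixes only. For these it controls the
    distance to \<open>q X\<close>, and \<open>q \<le> 1\<close> keeps the norm of
    \<open>q X\<close> below that of \<open>X\<close>.\<close>
  proof (cases "i = 0")
    case True
    with nonneg show ?thesis by simp
  next
    case False
    define q where "q = real i / real (length cs)"
    have q: "0 \<le> q" "q \<le> 1" using that by (auto simp: q_def divide_le_eq)
    let ?P = "sum_list (concat (take i cs))"
    have len: "length ws = length cs" using cs(2) by auto
    have P: "sum_list (take i ws) = \<epsilon> *\<^sub>R ?P" using scaled[of "take i cs"] cs(2) take_map by metis
    have "N (\<epsilon> *\<^sub>R (?P - q *\<^sub>R X)) \<le> S"
      using ws(2)[of i] False that by (simp add: P len sum_W q_def scaleR_diff_right mult.commute)
    then have "N (?P - q *\<^sub>R X) \<le> S / \<epsilon>"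
      using eps by (simp only: N_scale less_imp_le) (simp add: field_simps)
    moreover have "N (q *\<^sub>R X) \<le> t * ?\<rho>"
      using q N_nonneg N_X by (simp add: N_scale) (meson mult_left_le_one_le order_trans)
    ultimately show ?thesis using N_triangle[of "?P - q *\<^sub>R X" "q *\<^sub>R X"] by simp
  qed
  have "N (sum_list (take k (concat cs @ rs))) \<le> ?C" for k
  proof (cases "k < length (concat cs)")
    \<comment> \<open>All blocks are used up: their total \<open>X\<close> is already small, and a
      prefix of the remainder adds at most \<open>t\<close>.\<close>
    case False
    then have "sum_list (take k (concat cs @ rs)) = X + sum_list (take (k - length (concat cs)) rs)"
      using X_cs by simp
    then show ?thesis
      using N_triangle[of X "sum_list (take (k - length (concat cs)) rs)"]
        rs[of "k - length (concat cs)"] N_X nonneg by simp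
  next
    case True
    then have tk: "take k (concat cs @ rs) = take k (concat cs)" by simp
    show ?thesis
    proof (rule take_concat_cases[of k cs])
      assume "take k (concat cs) = concat cs"
      then show ?thesis using True by (simp add: take_all_iff)
    next
      fix i j assume ij: "i < length cs" "j < length (cs ! i)"
        "take k (concat cs) = concat (take i cs) @ take j (cs ! i)"
      have "cs ! i \<in> set bs" using nth_mem[OF ij(1)] set_cs by simp
      then have "N (sum_list (take j (cs ! i))) \<le> t" using bs ij(2) by blast
      with block[OF ij(1)] show ?thesis
        using N_triangle[of "sum_list (concat (take i cs))" "sum_list (take j (cs ! i))"]
        unfolding tk ij(3) sum_list_append by linarith
    qed
  qed
  moreover have "mset (concat cs @ rs) = V" using us cut mset_concat by simp
  ultimately show "\<exists>vs. mset vs = V \<and> (\<forall>k\<in>{1..length vs}.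
      N (sum_list (take k vs)) \<le> (S + (1 - \<epsilon>) * (?\<rho> + 1)) / \<epsilon>)"
    unfolding C by blast
qed

end

theorem theorem7:
  fixes B :: "(real ^ 'd) set" and \<epsilon> :: real
  assumes "CARD('d) \<ge> 2"
    and "convex_body B" and "0 \<in> interior B"
    and "0 < \<epsilon>" and "\<epsilon> \<le> 1"
  shows "steinitz_const B
           < (1 / \<epsilon>) * (relaxed_steinitz_const \<epsilon> B + 2 * asymmetry B + 1)"
proof -
  interpret norm_body B using assms(2,3) by unfold_locales
  let ?S = "relaxed_steinitz_const \<epsilon> B" and ?\<rho> = "asymmetry B"
  have "relaxed_steinitz_bound \<epsilon> B ?S" using assms(4) by (intro relaxed_steinitz_const_bound) simp
  then have "steinitz_const B \<le> (?S + (1 - \<epsilon>) * (?\<rho> + 1)) / \<epsilon>"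
    using assms(4,5) by (intro steinitz_const_least steinitz_bound_from_relaxed)
  also have "\<dots> < (?S + 2 * ?\<rho> + 1) / \<epsilon>"
  proof (rule divide_strict_right_mono[OF _ assms(4)])
    \<comment> \<open>Strictness comes from \<open>\<epsilon> > 0\<close> together with the
      positivity of \<open>?\<rho> + 1\<close>.\<close>
    have "(1 - \<epsilon>) * (?\<rho> + 1) < 1 * (?\<rho> + 1)"
      using assms(4) asymmetry_nonneg by (intro mult_strict_right_mono) auto
    also have "\<dots> \<le> 2 * ?\<rho> + 1" using asymmetry_nonneg by simp
    finally show "?S + (1 - \<epsilon>) * (?\<rho> + 1) < ?S + 2 * ?\<rho> + 1" by simp
  qed
  finally show ?thesis by simp
qed

end
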